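(* Let $r \le \min(M,N)$ be positive integers and let $\mathcal{P}=\mathcal{B}_{1,+}=\{\mathbf{x}\in\mathbb{R}^r \mid \mathbf{x}\ge\mathbf{0},\ \mathbf{1}^T\mathbf{x}\le 1\}$. Let $\mathbf{H}_g\in\mathbb{R}^{M\times r}$ have full column rank, let $\mathbf{S}_g\in\mathbb{R}^{r\times N}$ have all of its columns in $\mathcal{P}$, and set $\mathbf{Y}=\mathbf{H}_g\mathbf{S}_g$. Suppose $\mathbf{S}_g$ is a sufficiently scattered factor corresponding to $\mathcal{P}$ (as defined in the context). Consider the Det-Max optimization problem $$\max_{\mathbf{H}\in\mathbb{R}^{M\times r},\ \mathbf{S}\in\mathbb{R}^{r\times N}} \det(\mathbf{S}\mathbf{S}^T)\quad\text{subject to}\quad \mathbf{Y}=\mathbf{H}\mathbf{S},\ \ \mathbf{S}_{:,j}\in\mathcal{P}\ \ (j=1,\dots,N).$$ Then every global optimum $(\mathbf{H}_*,\mathbf{S}_* )$ of this problem satisfies $$\mathbf{H}_*=\mathbf{H}_g\boldsymbol{\Pi}^T,\qquad \mathbf{S}_*=\boldsymbol{\Pi}\mathbf{S}_g,$$ for some permutation matrix $\boldsymbol{\Pi}\in\mathbb{R}^{r\times r}$.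
   Context: $\mathbf{1}$ and $\mathbf{0}$ denote the all-ones and all-zeros vectors; $\mathbf{x}\ge\mathbf{0}$ is componentwise. $\mathbf{S}_{:,j}$ denotes the $j$-th column of $\mathbf{S}$; $\mathrm{conv}(\mathbf{S})$ is the convex hull of the columns of $\mathbf{S}$. For a convex polytope $\mathcal{P}\subset\mathbb{R}^r$ with nonempty interior, $\mathcal{E}_\mathcal{P}$ denotes its maximum volume inscribed ellipsoid (MVIE), i.e. the (unique) ellipsoid of maximal volume contained in $\mathcal{P}$, written $\mathcal{E}_\mathcal{P}=\{\mathbf{C}_\mathcal{P}\mathbf{u}+\mathbf{g}_\mathcal{P}\mid \|\mathbf{u}\|_2\le 1\}$ with $\mathbf{C}_\mathcal{P}\succeq 0$ and center $\mathbf{g}_\mathcal{P}$. For a set $C\subset\mathbb{R}^r$ and point $\mathbf{d}$, the polar of $C$ with respect to $\mathbf{d}$ is $C^{*,\mathbf{d}}=\{\mathbf{x}\in\mathbb{R}^r\mid \langle\mathbf{x},\mathbf{y}-\mathbf{d}\rangle\le 1\ \forall \mathbf{y}\in C\}$. $\mathrm{bd}(\cdot)$ denotes boundary and $\mathrm{ext}(\cdot)$ the set of extreme points (vertices). A matrix $\mathbf{S}\in\mathbb{R}^{r\times N}$ is called a sufficiently scattered factor corresponding to $\mathcal{P}$ if (i) $\mathcal{P}\supseteq\mathrm{conv}(\mathbf{S})\supset\mathcal{E}_\mathcal{P}$, and (ii) $\mathrm{conv}(\mathbf{S})^{*,\mathbf{g}_\mathcal{P}}\cap\mathrm{bd}(\mathcal{E}_\mathcal{P}^{*,\mathbf{g}_\mathcal{P}})=\mathrm{ext}(\mathcal{P}^{*,\mathbf{g}_\mathcal{P}})$.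 *)

theory Defs
  imports "HOL-Analysis.Analysis"
begin

text \<open>The polytope B_{1,+} = {x >= 0, 1^T x <= 1} in R^r.\<close>
definition simplex_B1plus :: "(real^'r) set" where
  "simplex_B1plus = {x. (\<forall>i. 0 \<le> x $ i) \<and> (\<Sum>i\<in>UNIV. x $ i) \<le> 1}"

text \<open>Symmetric positive semidefinite matrices.\<close>
definition psd :: "real^'r^'r \<Rightarrow> bool" where
  "psd C \<longleftrightarrow> transpose C = C \<and> (\<forall>u. 0 \<le> u \<bullet> (C *v u))"

text \<open>The ellipsoid {C u + g | norm u <= 1}.\<close>
definition ellipsoid :: "real^'r^'r \<Rightarrow> real^'r \<Rightarrow> (real^'r) set" where
  "ellipsoid C g = {C *v u + g | u. norm u \<le> 1}"

text \<open>(C, g) describes the maximum volume inscribed ellipsoid of P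
  (volume = Lebesgue measure).\<close>
definition is_MVIE :: "(real^'r) set \<Rightarrow> real^'r^'r \<Rightarrow> real^'r \<Rightarrow> bool" where
  "is_MVIE P C g \<longleftrightarrow> psd C \<and> ellipsoid C g \<subseteq> P \<and>
     (\<forall>C' g'. psd C' \<and> ellipsoid C' g' \<subseteq> P \<longrightarrow>
        emeasure lborel (ellipsoid C' g') \<le> emeasure lborel (ellipsoid C g))"

text \<open>Polar of a set C with respect to a point d.\<close>
definition polar_wrt :: "(real^'r) set \<Rightarrow> real^'r \<Rightarrow> (real^'r) set" where
  "polar_wrt C d = {x. \<forall>y\<in>C. x \<bullet> (y - d) \<le> 1}"

text \<open>Set of columns of a matrix (as a set of points).\<close>
definition col_set :: "real^'n^'r \<Rightarrow> (real^'r) set" where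
  "col_set S = {column j S | j. True}"

text \<open>Sufficiently scattered factor corresponding to P.\<close>
definition suff_scattered :: "real^'n^'r \<Rightarrow> (real^'r) set \<Rightarrow> bool" where
  "suff_scattered S P \<longleftrightarrow> (\<exists>C g. is_MVIE P C g \<and>
     convex hull (col_set S) \<subseteq> P \<and> ellipsoid C g \<subseteq> convex hull (col_set S) \<and>
     polar_wrt (convex hull (col_set S)) g \<inter> frontier (polar_wrt (ellipsoid C g) g)
       = {v. v extreme_point_of (polar_wrt P g)})"

text \<open>Permutation matrices.\<close>
definition perm_matrix :: "real^'r^'r \<Rightarrow> bool" where
  "perm_matrix Q \<longleftrightarrow> (\<exists>p. p permutes (UNIV::'r set) \<and>
     Q = (\<chi> i j. if p i = j then 1 else 0))"

end

(*
  Write the optimum as Ss = W Sg and Hs = Hg W^-1: this is possible because Hg has a left inverse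
  and Sg, whose convex hull contains the nondegenerate MVIE E = E(C, g) of P, has a right inverse.
  Optimality of Ss gives det (Ss Ss^T) >= det (Sg Sg^T), i.e. |det W| >= 1. Since W maps the columns
  of Sg into P, W E is an ellipsoid in P of at least maximal volume, so W E = E by uniqueness of
  the MVIE: W fixes g and W^T preserves the polar of E. Sufficient scatteredness then makes W^T
  permute the (finitely many) extreme points of the polar of P, and by the bipolar theorem W maps
  P onto P. A linear automorphism of the simplex B_{1,+} permutes its vertices e_i, so W is a
  permutation matrix, and W^-1 = W^T.
*)
theory Submission
  imports Defs
begin

section \<open>Volumes of linear images and of ellipsoids\<close>

definition det_scales_measure :: "(real^'n::finite \<Rightarrow> real^'n) \<Rightarrow> bool" where
  "det_scales_measure f \<longleftrightarrow> (\<forall>S \<in> lmeasurable. f ` S \<in> lmeasurable \<and>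
     measure lebesgue (f ` S) = \<bar>det (matrix f)\<bar> * measure lebesgue S)"

lemma det_scales_measure_comp:
  fixes f g :: "real^'n::finite \<Rightarrow> real^'n"
  assumes "linear f" "linear g" "det_scales_measure f" "det_scales_measure g"
  shows "det_scales_measure (f \<circ> g)"
  unfolding det_scales_measure_def
proof
  fix S :: "(real^'n) set"
  assume "S \<in> lmeasurable"
  with assms(4) have g: "g ` S \<in> lmeasurable"
    "measure lebesgue (g ` S) = \<bar>det (matrix g)\<bar> * measure lebesgue S"
    by (simp_all add: det_scales_measure_def)
  with assms(3) have "f ` g ` S \<in> lmeasurable"
    "measure lebesgue (f ` g ` S) = \<bar>det (matrix f)\<bar> * measure lebesgue (g ` S)"
    by (simp_all add: det_scales_measure_def)
  moreover have "det (matrix (f \<circ> g)) = det (matrix f) * det (matrix g)"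
    by (simp add: matrix_compose[OF assms(2,1)] det_mul)
  ultimately show "(f \<circ> g) ` S \<in> lmeasurable \<and>
      measure lebesgue ((f \<circ> g) ` S) = \<bar>det (matrix (f \<circ> g))\<bar> * measure lebesgue S"
    using g by (simp add: image_comp abs_mult mult.assoc)
qed

lemma det_scales_measure_singular:
  assumes "linear f" "\<not> inj f"
  shows "det_scales_measure f"
proof -
  have "det (matrix f) = 0"
    using det_nz_iff_inj[OF assms(1)] assms(2) by blast
  moreover have "negligible (f ` S)" for S
    using negligible_linear_singular_image[OF assms] .
  ultimately show ?thesis
    by (simp add: det_scales_measure_def negligible_imp_measure0 negligible_imp_measurable)
qed

lemma det_scales_measure_stretch: "det_scales_measure (\<lambda>x. \<chi> i. c i * x $ i)"
  by (simp add: det_scales_measure_def measurable_stretch measure_stretch matrix_def axis_def det_diagonal)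

lemma det_scales_measure_shear:
  fixes m n :: "'n::finite"
  defines "h \<equiv> \<lambda>x::real^'n. \<chi> i. if i = m then x $ m + x $ n else x $ i"
  assumes "m \<noteq> n"
  shows "det_scales_measure h"
proof -
  have lin: "linear h"
    unfolding h_def by (rule linearI) (auto simp: vec_eq_iff algebra_simps)
  have "matrix h = (\<chi> k. if k = m then row m (mat 1) + 1 *s row n (mat 1) else row k (mat 1 :: real^'n^'n))"
    by (auto simp: h_def matrix_def axis_def row_def mat_def vec_eq_iff)
  then have det: "det (matrix h) = 1"
    using det_row_operation[OF assms(2), of "mat 1 :: real^'n^'n" 1] by simp
  have box: "measure lebesgue (h ` cbox a b) = 1 * measure lebesgue (cbox a b)" for a b
  proof (cases "cbox a b = {}")
    case False
    \<comment> \<open>\<open>measure_shear_interval\<close> needs a box with nonnegative n-th lower corner\<close>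
    define v :: "real^'n" where "v = axis n (a $ n)"
    have "h ` cbox a b = (+) (h v) ` h ` cbox (a - v) (b - v)"
      using cbox_translation[of v "a - v" "b - v"] linear_add[OF lin]
      by (simp add: image_image)
    then have "measure lebesgue (h ` cbox a b) = measure lebesgue (h ` cbox (a - v) (b - v))"
      by (simp add: measure_translation)
    also have "\<dots> = measure lebesgue (cbox (a - v) (b - v))"
      unfolding h_def using False \<open>m \<noteq> n\<close>
      by (intro measure_shear_interval) (auto simp: v_def box_ne_empty inner_diff_left)
    also have "\<dots> = measure lebesgue (cbox a b)"
      using cbox_translation[of v "a - v" "b - v"] by (simp add: measure_translation)
    finally show ?thesis by simp
  qed simp
  have "h ` S \<in> lmeasurable \<and> measure lebesgue (h ` S) = measure lebesgue S" if "S \<in> lmeasurable" for S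
    using measure_linear_sufficient[OF lin that box] by simp
  then show ?thesis
    unfolding det_scales_measure_def det by simp
qed

lemma swap_as_shears:
  fixes m n :: "'n::finite"
  defines "shear \<equiv> \<lambda>m n (x::real^'n). \<chi> i. if i = m then x $ m + x $ n else x $ i"
    and "neg \<equiv> \<lambda>k (x::real^'n). \<chi> i. (if i = k then -1 else 1) * x $ i"
  assumes "m \<noteq> n"
  shows "(\<lambda>x. \<chi> i. x $ Transposition.transpose m n i)
       = neg n \<circ> shear m n \<circ> neg m \<circ> shear n m \<circ> neg m \<circ> shear m n"
  using assms(3) by (auto simp: shear_def neg_def vec_eq_iff Transposition.transpose_def)

text \<open>The library version \<open>measure_linear_image\<close> assumes a well-ordered index type, which it needs
  only to compute the determinant of a shear from a triangular matrix.\<close>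
lemma measure_linear_image_finite:
  fixes f :: "real^'n::finite \<Rightarrow> real^'n"
  assumes "linear f" "S \<in> lmeasurable"
  shows "measure lebesgue (f ` S) = \<bar>det (matrix f)\<bar> * measure lebesgue S"
proof -
  have lin_stretch: "linear (\<lambda>x::real^'n. \<chi> i. c i * x $ i)" for c
    by (rule linearI) (auto simp: vec_eq_iff algebra_simps)
  have lin_shear: "linear (\<lambda>x::real^'n. \<chi> i. if i = m then x $ m + x $ n else x $ i)" for m n :: 'n
    by (rule linearI) (auto simp: vec_eq_iff algebra_simps)
  have "det_scales_measure f"
  proof (rule induct_linear_elementary[OF \<open>linear f\<close>])
    show "det_scales_measure (f \<circ> g)"
      if "linear f" "linear g" "det_scales_measure f" "det_scales_measure g" for f g
      using that by (rule det_scales_measure_comp)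
    show "det_scales_measure f" if "linear f" "\<And>x. f x $ i = 0" for f i
    proof (rule det_scales_measure_singular[OF that(1)])
      show "\<not> inj f"
        by (metis that one_neq_zero vec_component linear_injective_imp_surjective surjE)
    qed
    show "det_scales_measure (\<lambda>x. \<chi> i. c i * x $ i)" for c
      by (rule det_scales_measure_stretch)
    show "det_scales_measure (\<lambda>x. \<chi> i. x $ Transposition.transpose m n i)" if "m \<noteq> n" for m n :: 'n
      unfolding swap_as_shears[OF that]
      by (intro det_scales_measure_comp linear_compose lin_stretch lin_shear det_scales_measure_stretch
          det_scales_measure_shear that that[symmetric])
    show "det_scales_measure (\<lambda>x. \<chi> i. if i = m then x $ m + x $ n else x $ i)" if "m \<noteq> n" for m n :: 'n
      using that by (rule det_scales_measure_shear)
  qed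
  with assms(2) show ?thesis
    by (simp add: det_scales_measure_def)
qed

lemma ellipsoid_eq_image: "ellipsoid A h = (\<lambda>u. A *v u + h) ` cball 0 1"
  unfolding ellipsoid_def by (auto simp: dist_norm)

lemma ellipsoidI: "norm u \<le> 1 \<Longrightarrow> A *v u + h \<in> ellipsoid A h"
  unfolding ellipsoid_def by blast

lemma ellipsoidE:
  assumes "x \<in> ellipsoid A h"
  obtains u where "norm u \<le> 1" "x = A *v u + h"
  using assms unfolding ellipsoid_def by blast

lemma center_in_ellipsoid: "h \<in> ellipsoid A h"
  using ellipsoidI[of 0 A h] by simp

lemma compact_ellipsoid: "compact (ellipsoid (A::real^'n::finite^'n) h)"
  unfolding ellipsoid_eq_image
  by (intro compact_continuous_image compact_cball continuous_intros)

lemma emeasure_ellipsoid: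
  fixes A :: "real^'n::finite^'n"
  shows "emeasure lborel (ellipsoid A h) = ennreal (\<bar>det A\<bar> * measure lborel (cball (0::real^'n) 1))"
proof -
  have "ellipsoid A h = (+) h ` (*v) A ` cball 0 1"
    unfolding ellipsoid_eq_image by (auto simp: image_image add.commute)
  then have "measure lebesgue (ellipsoid A h) = \<bar>det A\<bar> * measure lebesgue (cball (0::real^'n) 1)"
    using measure_linear_image_finite[OF matrix_vector_mul_linear lmeasurable_cball]
    by (simp add: measure_translation)
  moreover have "emeasure lborel (ellipsoid A h) = measure lebesgue (ellipsoid A h)"
    using compact_ellipsoid[of A h] emeasure_compact_finite[of "ellipsoid A h"]
    by (simp add: emeasure_eq_ennreal_measure borel_compact measure_completion)
  ultimately show ?thesis
    by (simp add: measure_completion)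
qed

lemma MVIE_abs_det_le_psd:
  fixes C :: "real^'n::finite^'n"
  assumes "is_MVIE P C g" "psd C'" "ellipsoid C' g' \<subseteq> P"
  shows "\<bar>det C'\<bar> \<le> \<bar>det C\<bar>"
proof -
  have "emeasure lborel (ellipsoid C' g') \<le> emeasure lborel (ellipsoid C g)"
    using assms unfolding is_MVIE_def by blast
  moreover have "measure lborel (cball (0::real^'n) 1) > 0"
    using content_cball_pos[of 1 "0::real^'n"] by simp
  ultimately show ?thesis
    by (simp add: emeasure_ellipsoid ennreal_le_iff)
qed

section \<open>Diagonalisation of symmetric matrices\<close>

definition diag_mat :: "real^'n::finite \<Rightarrow> real^'n^'n" where
  "diag_mat d = (\<chi> i j. if i = j then d $ i else 0)"

lemma diag_mat_mult_vector [simp]: "diag_mat d *v x = (\<chi> i. d $ i * x $ i)"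
  by (simp add: diag_mat_def matrix_vector_mult_def vec_eq_iff if_distrib[of "\<lambda>x. x * _"] cong: if_cong)

lemma transpose_diag_mat [simp]: "transpose (diag_mat d) = diag_mat d"
  by (simp add: diag_mat_def transpose_def vec_eq_iff)

lemma det_diag_mat [simp]: "det (diag_mat d) = (\<Prod>i\<in>UNIV. d $ i)"
  by (subst det_diagonal) (auto simp: diag_mat_def)

lemma diag_mat_mult_diag_mat: "diag_mat a ** diag_mat b = diag_mat (\<chi> i. a $ i * b $ i)"
  by (simp add: diag_mat_def matrix_matrix_mult_def vec_eq_iff if_distrib[of "\<lambda>x. x * _"] cong: if_cong)

lemma inner_matrix_vector_transpose:
  fixes A :: "real^'n::finite^'m::finite"
  shows "x \<bullet> (A *v y) = (transpose A *v x) \<bullet> y"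
  by (metis dot_lmul_matrix inner_commute vector_transpose_matrix)

lemma column_matrix_mult: "column j (A ** B) = A *v column j B"
  by (simp add: column_def matrix_matrix_mult_def matrix_vector_mult_def vec_eq_iff)

lemma column_mult_diag_mat: "column j (U ** diag_mat d) = d $ j *\<^sub>R column j U"
  by (simp add: column_def matrix_matrix_mult_def diag_mat_def vec_eq_iff if_distrib[of "\<lambda>x. _ * x"] cong: if_cong)

lemma linear_coefficient_zero_if_quadratic_nonpos:
  fixes a b :: real
  assumes "\<And>t. 2 * t * a + t\<^sup>2 * b \<le> 0"
  shows "a = 0"
proof (rule ccontr)
  assume "a \<noteq> 0"
  define s where "s = 1 / (\<bar>b\<bar> + 1)"
  have "s > 0" "\<bar>s * b\<bar> < 1"
    by (auto simp: s_def field_simps abs_mult)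
  then have "0 < a\<^sup>2 * s * (2 + s * b)"
    using \<open>a \<noteq> 0\<close> by (intro mult_pos_pos) (auto simp: abs_less_iff)
  also have "\<dots> = 2 * (s * a) * a + (s * a)\<^sup>2 * b"
    by (simp add: power2_eq_square algebra_simps)
  finally show False
    using assms[of "s * a"] by linarith
qed

lemma eigenvector_if_max_quadratic_form:
  fixes A :: "real^'n::finite^'n"
  assumes sym: "transpose A = A" and V: "subspace V" and inv: "\<And>y. y \<in> V \<Longrightarrow> A *v y \<in> V"
    and v: "v \<in> V" "norm v = 1"
    and max: "\<And>y. y \<in> V \<Longrightarrow> norm y = 1 \<Longrightarrow> y \<bullet> (A *v y) \<le> v \<bullet> (A *v v)"
  shows "A *v v = (v \<bullet> (A *v v)) *\<^sub>R v"
proof -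
  define l where "l = v \<bullet> (A *v v)"
  have symm: "x \<bullet> (A *v y) = y \<bullet> (A *v x)" for x y
    using inner_matrix_vector_transpose[of x A y] sym by (simp add: inner_commute)
  have homog: "y \<bullet> (A *v y) \<le> l * (y \<bullet> y)" if "y \<in> V" for y
  proof (cases "y = 0")
    case False
    then have "(y /\<^sub>R norm y) \<bullet> (A *v (y /\<^sub>R norm y)) \<le> l"
      unfolding l_def using that by (intro max) (auto simp: V subspace_scale)
    then show ?thesis
      using False by (simp add: matrix_vector_mult_scaleR dot_square_norm power2_eq_square field_simps)
  qed simp
  have vv: "v \<bullet> v = 1"
    using v by (simp add: dot_square_norm)
  have orth: "y \<bullet> (A *v v) = 0" if "y \<in> V" "y \<bullet> v = 0" for y
  proof (rule linear_coefficient_zero_if_quadratic_nonpos)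
    fix t :: real
    have "v + t *\<^sub>R y \<in> V"
      using V v that by (simp add: subspace_add subspace_scale)
    from homog[OF this] show "2 * t * (y \<bullet> (A *v v)) + t\<^sup>2 * (y \<bullet> (A *v y) - l * (y \<bullet> y)) \<le> 0"
      using that vv symm[of v y]
      by (simp add: l_def matrix_vector_right_distrib matrix_vector_mult_scaleR inner_add_left
          inner_add_right inner_commute power2_eq_square algebra_simps)
  qed
  define z where "z = A *v v - l *\<^sub>R v"
  have "z \<in> V"
    unfolding z_def using V v inv by (simp add: subspace_diff subspace_scale)
  moreover have "z \<bullet> v = 0"
    using vv by (simp add: z_def l_def inner_diff_left inner_commute[of "A *v v"])
  ultimately have "z \<bullet> z = 0"
    using orth by (simp add: z_def inner_diff_right)
  then show ?thesis
    by (simp add: z_def l_def)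
qed

lemma eigenvector_in_invariant_subspace:
  fixes A :: "real^'n::finite^'n"
  assumes sym: "transpose A = A" and V: "subspace V" "V \<noteq> {0}"
    and inv: "\<And>y. y \<in> V \<Longrightarrow> A *v y \<in> V"
  obtains v where "v \<in> V" "norm v = 1" "A *v v = (v \<bullet> (A *v v)) *\<^sub>R v"
proof -
  obtain x where "x \<in> V" "x \<noteq> 0"
    using V subspace_0 by blast
  then have "x /\<^sub>R norm x \<in> V \<inter> sphere 0 1"
    using V by (simp add: subspace_scale)
  moreover have "compact (V \<inter> sphere 0 1)"
    using V by (intro closed_Int_compact closed_subspace compact_sphere)
  moreover have "continuous_on (V \<inter> sphere 0 1) (\<lambda>y. y \<bullet> (A *v y))"
    by (intro continuous_intros linear_continuous_on matrix_vector_mul_bounded_linear)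
  ultimately obtain v where v: "v \<in> V" "norm v = 1"
    and max: "\<And>y. y \<in> V \<Longrightarrow> norm y = 1 \<Longrightarrow> y \<bullet> (A *v y) \<le> v \<bullet> (A *v v)"
    using continuous_attains_sup[of "V \<inter> sphere 0 1" "\<lambda>y. y \<bullet> (A *v y)"] by fastforce
  then show ?thesis
    using eigenvector_if_max_quadratic_form[OF sym V(1) inv v max] that by blast
qed

lemma symmetric_orthonormal_eigenvectors:
  fixes A :: "real^'n::finite^'n"
  assumes sym: "transpose A = A"
  shows "k \<le> CARD('n) \<Longrightarrow> \<exists>S. finite S \<and> card S = k \<and> pairwise orthogonal S \<and>
           (\<forall>v\<in>S. norm v = 1 \<and> A *v v = (v \<bullet> (A *v v)) *\<^sub>R v)"
proof (induction k)
  case (Suc k)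
  then obtain S where S: "finite S" "card S = k" "pairwise orthogonal S"
    and eig: "\<And>v. v \<in> S \<Longrightarrow> norm v = 1 \<and> A *v v = (v \<bullet> (A *v v)) *\<^sub>R v"
    by auto
  define V where "V = {y. \<forall>w\<in>S. w \<bullet> y = 0}"
  have V: "subspace V"
    by (auto simp: V_def subspace_def inner_add_right)
  have inv: "A *v y \<in> V" if "y \<in> V" for y
  proof -
    have "w \<bullet> (A *v y) = (w \<bullet> (A *v w)) * (w \<bullet> y)" if "w \<in> S" for w
      using inner_matrix_vector_transpose[of w A y] sym eig[OF that] by (metis inner_scaleR_left)
    then show ?thesis
      using \<open>y \<in> V\<close> by (simp add: V_def)
  qed
  have "dim S < DIM(real^'n)"
    using dim_le_card[OF subset_refl S(1)] S(2) Suc.prems by simp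
  then obtain x where "x \<noteq> 0" and "\<And>y. y \<in> span S \<Longrightarrow> orthogonal x y"
    using orthogonal_to_subspace_exists[of S] by blast
  then have "x \<in> V"
    using span_superset by (auto simp: V_def orthogonal_def inner_commute)
  with \<open>x \<noteq> 0\<close> obtain v where v: "v \<in> V" "norm v = 1" "A *v v = (v \<bullet> (A *v v)) *\<^sub>R v"
    using eigenvector_in_invariant_subspace[OF sym V _ inv] by blast
  have "v \<notin> S"
    using v by (auto simp: V_def)
  show ?case
  proof (intro exI[of _ "insert v S"] conjI)
    show "pairwise orthogonal (insert v S)"
      using S(3) v(1) by (auto simp: pairwise_insert V_def orthogonal_def inner_commute)
    show "\<forall>w\<in>insert v S. norm w = 1 \<and> A *v w = (w \<bullet> (A *v w)) *\<^sub>R w"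
      using eig v by blast
  qed (use S \<open>v \<notin> S\<close> in auto)
qed auto

theorem symmetric_matrix_diagonalization:
  fixes A :: "real^'n::finite^'n"
  assumes sym: "transpose A = A"
  obtains U d where "orthogonal_matrix U" "A = U ** diag_mat d ** transpose U"
proof -
  obtain S where S: "finite S" "card S = CARD('n)" "pairwise orthogonal S"
    and eig: "\<And>v. v \<in> S \<Longrightarrow> norm v = 1 \<and> A *v v = (v \<bullet> (A *v v)) *\<^sub>R v"
    using symmetric_orthonormal_eigenvectors[OF sym, of "CARD('n)"] by auto
  obtain f where f: "bij_betw f (UNIV::'n set) S"
    using finite_same_card_bij[of "UNIV::'n set" S] S by auto
  then have fS: "f j \<in> S" and f_eq: "f i = f j \<longleftrightarrow> i = j" for i j
    by (auto simp: bij_betw_def inj_def)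
  define U :: "real^'n^'n" where "U = (\<chi> i j. f j $ i)"
  define d :: "real^'n" where "d = (\<chi> j. f j \<bullet> (A *v f j))"
  have col: "column j U = f j" for j
    by (simp add: U_def column_def vec_eq_iff)
  have U: "orthogonal_matrix U"
    unfolding orthogonal_matrix_orthonormal_columns col
    using S(3) eig fS f_eq by (auto simp: pairwise_def)
  have "column j (A ** U) = column j (U ** diag_mat d)" for j
    using eig[OF fS, of j] unfolding column_matrix_mult[of _ A] column_mult_diag_mat col d_def vec_lambda_beta
    by blast
  then have "A ** U = U ** diag_mat d"
    by (simp add: column_def vec_eq_iff)
  then have "A = U ** diag_mat d ** transpose U"
    using U unfolding orthogonal_matrix_def by (metis matrix_mul_assoc matrix_mul_rid)
  with U that show ?thesis by blast
qed

lemma transpose_mult_column_orthogonal: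
  fixes U :: "real^'n::finite^'n"
  assumes "orthogonal_matrix U"
  shows "transpose U *v column i U = axis i 1"
proof -
  have "transpose U *v column i U = column i (transpose U ** U)"
    by (simp add: column_matrix_mult)
  also have "\<dots> = axis i 1"
    using assms by (simp add: orthogonal_matrix_def column_def mat_def axis_def vec_eq_iff)
  finally show ?thesis .
qed

lemma orthogonal_conj_diag_mat_column:
  fixes U :: "real^'n::finite^'n"
  assumes "orthogonal_matrix U"
  shows "(U ** diag_mat d ** transpose U) *v column i U = d $ i *\<^sub>R column i U"
proof -
  have "(U ** diag_mat d ** transpose U) *v column i U = U *v (diag_mat d *v (transpose U *v column i U))"
    by (simp add: matrix_vector_mul_assoc matrix_mul_assoc del: transpose_matrix_vector)
  also have "\<dots> = U *v (d $ i *\<^sub>R axis i 1)"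
  proof -
    have "diag_mat d *v axis i 1 = d $ i *\<^sub>R axis i 1"
      by (simp add: axis_def vec_eq_iff)
    then show ?thesis
      by (simp only: transpose_mult_column_orthogonal[OF assms])
  qed
  also have "\<dots> = d $ i *\<^sub>R column i U"
    by (simp add: matrix_vector_mult_scaleR matrix_vector_mult_basis)
  finally show ?thesis .
qed

lemma orthogonal_conj_diag_mat_eigenvalue:
  fixes U :: "real^'n::finite^'n"
  assumes "orthogonal_matrix U"
  shows "d $ i = column i U \<bullet> ((U ** diag_mat d ** transpose U) *v column i U)"
  using assms orthogonal_conj_diag_mat_column[OF assms]
  by (simp add: orthogonal_matrix_orthonormal_columns dot_square_norm)

lemma det_orthogonal_conj_diag_mat:
  fixes U :: "real^'n::finite^'n"
  assumes "orthogonal_matrix U"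
  shows "det (U ** diag_mat d ** transpose U) = (\<Prod>i\<in>UNIV. d $ i)"
proof -
  have "det U * det U = 1"
    using assms unfolding orthogonal_matrix_def by (metis det_I det_mul det_transpose)
  then show ?thesis
    by (simp add: det_mul det_transpose)
qed

lemma quadratic_form_conj_diag_mat:
  fixes U :: "real^'n::finite^'n"
  shows "x \<bullet> ((U ** diag_mat d ** transpose U) *v x) = (\<Sum>i\<in>UNIV. d $ i * ((transpose U *v x) $ i)\<^sup>2)"
  using inner_matrix_vector_transpose[of x U "diag_mat d *v (transpose U *v x)"]
  by (simp add: matrix_vector_mul_assoc[symmetric] inner_vec_def power2_eq_square mult_ac
      del: transpose_matrix_vector)

lemma psd_conj_diag_mat:
  fixes U :: "real^'n::finite^'n"
  assumes "\<And>i. 0 \<le> d $ i"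
  shows "psd (U ** diag_mat d ** transpose U)"
  unfolding psd_def quadratic_form_conj_diag_mat
  using assms by (auto simp: matrix_transpose_mul matrix_mul_assoc intro!: sum_nonneg)

lemma det_pos_if_pos_definite:
  fixes A :: "real^'n::finite^'n"
  assumes "transpose A = A" and "\<And>x. x \<noteq> 0 \<Longrightarrow> 0 < x \<bullet> (A *v x)"
  shows "0 < det A"
proof -
  obtain U d where U: "orthogonal_matrix U" and A: "A = U ** diag_mat d ** transpose U"
    using symmetric_matrix_diagonalization[OF assms(1)] by blast
  have "column i U \<noteq> 0" for i
    using U by (metis orthogonal_matrix_orthonormal_columns norm_zero zero_neq_one)
  then have "0 < d $ i" for i
    using orthogonal_conj_diag_mat_eigenvalue[OF U, of d i] assms(2)[of "column i U"] by (simp add: A)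
  then show ?thesis
    by (simp add: A det_orthogonal_conj_diag_mat[OF U] prod_pos)
qed

lemma ellipsoid_mult_orthogonal:
  fixes R Q :: "real^'n::finite^'n"
  assumes "orthogonal_matrix Q"
  shows "ellipsoid (R ** Q) h = ellipsoid R h"
proof -
  have "orthogonal_transformation ((*v) Q)"
    using assms by (simp add: orthogonal_transformation_matrix)
  then have "(*v) Q ` cball 0 1 = cball 0 1"
    using image_orthogonal_transformation_cball[of "(*v) Q" 0 1] by simp
  moreover have "(\<lambda>u. (R ** Q) *v u + h) ` cball 0 1 = (\<lambda>u. R *v u + h) ` (*v) Q ` cball 0 1"
    by (simp add: image_image matrix_vector_mul_assoc)
  ultimately show ?thesis
    unfolding ellipsoid_eq_image by simp
qed

lemma psd_sqrt_gram:
  fixes M :: "real^'n::finite^'n"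
  assumes "det M \<noteq> 0"
  obtains R where "psd R" "0 < det R" "R ** R = M ** transpose M"
proof -
  define G where "G = M ** transpose M"
  obtain U \<mu> where U: "orthogonal_matrix U" and G: "G = U ** diag_mat \<mu> ** transpose U"
    using symmetric_matrix_diagonalization[of G] by (metis G_def matrix_transpose_mul transpose_transpose)
  have "inj ((*v) (transpose M))"
    using assms det_nz_iff_inj[OF matrix_vector_mul_linear, of "transpose M"]
    by (simp add: det_transpose del: transpose_matrix_vector)
  then have "transpose M *v column i U \<noteq> 0" for i
    using U by (metis (no_types, lifting) orthogonal_matrix_orthonormal_columns matrix_vector_mult_0_right injD norm_zero zero_neq_one)
  then have \<mu>_pos: "0 < \<mu> $ i" for i
    using orthogonal_conj_diag_mat_eigenvalue[OF U, of \<mu> i]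
      inner_matrix_vector_transpose[of "column i U" M "transpose M *v column i U"]
    by (simp add: G[symmetric] G_def matrix_vector_mul_assoc[symmetric] del: transpose_matrix_vector)
  define R where "R = U ** diag_mat (\<chi> i. sqrt (\<mu> $ i)) ** transpose U"
  have "psd R"
    unfolding R_def by (rule psd_conj_diag_mat) (simp add: \<mu>_pos less_imp_le)
  moreover have "0 < det R"
    using \<mu>_pos by (simp add: R_def det_orthogonal_conj_diag_mat[OF U] prod_pos)
  moreover have "R ** R = U ** (diag_mat (\<chi> i. sqrt (\<mu> $ i)) ** (transpose U ** U) ** diag_mat (\<chi> i. sqrt (\<mu> $ i))) ** transpose U"
    by (simp add: R_def matrix_mul_assoc)
  then have "R ** R = G"
    using U \<mu>_pos by (simp add: G orthogonal_matrix_def diag_mat_mult_diag_mat less_imp_le)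
  ultimately show ?thesis
    using that G_def by blast
qed

text \<open>Polar decomposition: \<open>M = R ** Q\<close> with \<open>Q = Ri ** M\<close> orthogonal, and Q fixes the unit ball.\<close>
lemma ellipsoid_eq_psd_ellipsoid:
  fixes M :: "real^'n::finite^'n"
  assumes "det M \<noteq> 0"
  obtains R where "psd R" "det R = \<bar>det M\<bar>" "R ** R = M ** transpose M"
    "\<And>h. ellipsoid M h = ellipsoid R h"
proof -
  obtain R where psd: "psd R" and "0 < det R" and RR: "R ** R = M ** transpose M"
    using psd_sqrt_gram[OF assms] by blast
  moreover have "det R * det R = det M * det M"
    by (metis RR det_mul det_transpose)
  ultimately have det: "det R = \<bar>det M\<bar>"
    by (metis abs_of_pos real_sqrt_abs2)
  then obtain Ri where Ri: "R ** Ri = mat 1" "Ri ** R = mat 1"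
    using assms invertible_det_nz[of R] unfolding invertible_def by auto
  have "transpose R = R"
    using psd by (simp add: psd_def)
  have "(Ri ** M) ** transpose (Ri ** M) = Ri ** (M ** transpose M) ** transpose Ri"
    by (simp add: matrix_transpose_mul matrix_mul_assoc)
  also have "\<dots> = (Ri ** R) ** R ** transpose Ri"
    by (simp add: RR[symmetric] matrix_mul_assoc)
  also have "\<dots> = transpose (Ri ** R)"
    using Ri(2) \<open>transpose R = R\<close> by (metis matrix_mul_lid matrix_transpose_mul)
  finally have "(Ri ** M) ** transpose (Ri ** M) = mat 1"
    using Ri by simp
  then have "orthogonal_matrix (Ri ** M)"
    by (simp add: orthogonal_matrix matrix_left_right_inverse)
  moreover have "M = R ** (Ri ** M)"
    using Ri by (simp add: matrix_mul_assoc)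
  ultimately have "ellipsoid M h = ellipsoid R h" for h
    by (metis ellipsoid_mult_orthogonal)
  with psd det RR show ?thesis
    using that by blast
qed

section \<open>Uniqueness of the maximum volume inscribed ellipsoid\<close>

lemma ellipsoid_affine_image:
  fixes C :: "real^'n::finite^'n"
  shows "(\<lambda>y. C *v y + g) ` ellipsoid A h = ellipsoid (C ** A) (C *v h + g)"
  unfolding ellipsoid_eq_image image_image
  by (simp add: matrix_vector_right_distrib matrix_vector_mul_assoc add.assoc)

lemma ellipsoid_midpoint_subset:
  fixes A B :: "real^'n::finite^'n"
  assumes "convex Q" "ellipsoid A h \<subseteq> Q" "ellipsoid B k \<subseteq> Q"
  shows "ellipsoid ((1/2) *\<^sub>R (A + B)) ((1/2) *\<^sub>R (h + k)) \<subseteq> Q"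
proof
  fix x
  assume "x \<in> ellipsoid ((1/2) *\<^sub>R (A + B)) ((1/2) *\<^sub>R (h + k))"
  then obtain u where u: "norm u \<le> 1" "x = ((1/2) *\<^sub>R (A + B)) *v u + (1/2) *\<^sub>R (h + k)"
    by (rule ellipsoidE)
  then have "x = (1/2) *\<^sub>R (A *v u + h) + (1/2) *\<^sub>R (B *v u + k)"
    by (simp add: scaleR_matrix_vector_assoc[symmetric] matrix_vector_mult_add_rdistrib algebra_simps)
  moreover have "A *v u + h \<in> Q" "B *v u + k \<in> Q"
    using assms(2,3) ellipsoidI[OF u(1)] by blast+
  ultimately show "x \<in> Q"
    using convexD[OF assms(1), of "A *v u + h" "B *v u + k" "1/2" "1/2"] by simp
qed

lemma prod_midpoints_gt_one:
  fixes \<rho> :: "'n::finite \<Rightarrow> real"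
  assumes "\<And>i. 0 \<le> \<rho> i" "1 \<le> (\<Prod>i\<in>UNIV. \<rho> i)" "\<rho> j \<noteq> 1"
  shows "1 < (\<Prod>i\<in>UNIV. (1 + \<rho> i) / 2)"
proof -
  have "1 \<le> (\<Prod>i\<in>UNIV. \<rho> i)"
    by (rule assms(2))
  also have "\<dots> < (\<Prod>i\<in>UNIV. ((1 + \<rho> i) / 2)\<^sup>2)"
  proof (rule prod_mono_strict[of j])
    have gap: "((1 + \<rho> i) / 2)\<^sup>2 - \<rho> i = ((1 - \<rho> i) / 2)\<^sup>2" for i
      by (simp add: power2_eq_square field_simps)
    have "0 < ((1 - \<rho> j) / 2)\<^sup>2"
      using assms(3) by simp
    then show "\<rho> j < ((1 + \<rho> j) / 2)\<^sup>2"
      using gap[of j] by linarith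
    show "0 \<le> \<rho> i \<and> \<rho> i \<le> ((1 + \<rho> i) / 2)\<^sup>2" for i
      using gap[of i] assms(1)[of i] zero_le_power2[of "(1 - \<rho> i) / 2"] by linarith
    show "0 < ((1 + \<rho> i) / 2)\<^sup>2" for i
      using assms(1)[of i] by (simp add: add_pos_nonneg)
  qed simp_all
  also have "\<dots> = (\<Prod>i\<in>UNIV. (1 + \<rho> i) / 2)\<^sup>2"
    by (simp add: prod_power_distrib)
  finally have "1 < (\<Prod>i\<in>UNIV. (1 + \<rho> i) / 2)\<^sup>2" .
  moreover have "0 \<le> (\<Prod>i\<in>UNIV. (1 + \<rho> i) / 2)"
    using assms(1) by (simp add: prod_nonneg add_nonneg_nonneg)
  ultimately show ?thesis
    using power_le_one[of "\<Prod>i\<in>UNIV. (1 + \<rho> i) / 2" 2] by linarith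
qed

lemma affine_combination_orthogonal_conj_diag_mat:
  fixes U :: "real^'n::finite^'n"
  assumes "orthogonal_matrix U"
  shows "a *\<^sub>R mat 1 + b *\<^sub>R (U ** diag_mat d ** transpose U)
       = U ** diag_mat (\<chi> i. a + b * d $ i) ** transpose U"
  unfolding matrix_eq
proof
  fix x
  define y where "y = transpose U *v x"
  have "U *v y = x"
    using assms by (simp add: y_def orthogonal_matrix_def matrix_vector_mul_assoc del: transpose_matrix_vector)
  have "diag_mat (\<chi> i. a + b * d $ i) *v y = a *\<^sub>R y + b *\<^sub>R (diag_mat d *v y)"
    by (simp add: vec_eq_iff algebra_simps)
  then have "(U ** diag_mat (\<chi> i. a + b * d $ i) ** transpose U) *v x
      = a *\<^sub>R (U *v y) + b *\<^sub>R (U *v (diag_mat d *v y))"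
    by (simp add: y_def matrix_vector_mul_assoc[symmetric] matrix_vector_right_distrib
        matrix_vector_mult_scaleR del: transpose_matrix_vector)
  also have "\<dots> = (a *\<^sub>R mat 1 + b *\<^sub>R (U ** diag_mat d ** transpose U)) *v x"
    using \<open>U *v y = x\<close>
    by (simp add: y_def matrix_vector_mult_add_rdistrib scaleR_matrix_vector_assoc[symmetric]
        matrix_vector_mul_assoc[symmetric] del: transpose_matrix_vector)
  finally show "(a *\<^sub>R mat 1 + b *\<^sub>R (U ** diag_mat d ** transpose U)) *v x
      = (U ** diag_mat (\<chi> i. a + b * d $ i) ** transpose U) *v x" ..
qed

lemma det_midpoint_identity_gt_one:
  fixes R :: "real^'n::finite^'n"
  assumes "psd R" "1 \<le> det R" "R \<noteq> mat 1"
  shows "1 < det ((1/2) *\<^sub>R (mat 1 + R))"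
proof -
  obtain U \<rho> where U: "orthogonal_matrix U" and R: "R = U ** diag_mat \<rho> ** transpose U"
    using symmetric_matrix_diagonalization[of R] assms(1) by (auto simp: psd_def)
  have \<rho>_nonneg: "0 \<le> \<rho> $ i" for i
    using assms(1) orthogonal_conj_diag_mat_eigenvalue[OF U, of \<rho> i] by (simp add: psd_def R)
  obtain j where "\<rho> $ j \<noteq> 1"
  proof (rule ccontr)
    assume "\<not> thesis"
    then have "diag_mat \<rho> = mat 1"
      using that by (auto simp: diag_mat_def mat_def vec_eq_iff)
    then have "R = mat 1"
      using U by (simp add: R orthogonal_matrix_def)
    with assms(3) show False ..
  qed
  have "1 < (\<Prod>i\<in>UNIV. (1 + \<rho> $ i) / 2)"
    using prod_midpoints_gt_one[of "\<lambda>i. \<rho> $ i" j] \<rho>_nonneg assms(2) \<open>\<rho> $ j \<noteq> 1\<close>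
    by (simp add: R det_orthogonal_conj_diag_mat[OF U])
  then show ?thesis
    by (simp add: R scaleR_right_distrib affine_combination_orthogonal_conj_diag_mat[OF U]
        det_orthogonal_conj_diag_mat[OF U] add_divide_distrib)
qed

lemma ellipsoid_identity: "ellipsoid (mat 1) h = cball h (1::real)"
proof -
  have "cball h 1 = (+) h ` cball 0 1"
    using cball_translation[of h 0 1] by simp
  then show ?thesis
    unfolding ellipsoid_eq_image by (simp add: add.commute)
qed

lemma orthogonal_conj_coordinate_projection:
  fixes Q :: "real^'n::finite^'n"
  assumes "orthogonal_matrix Q"
  shows "(Q ** diag_mat (\<chi> i. if i = e then 1 else 0) ** transpose Q) *v x = (column e Q \<bullet> x) *\<^sub>R column e Q"
proof -
  have "(transpose Q *v x) $ e = column e Q \<bullet> x"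
    by (simp add: column_def inner_vec_def matrix_vector_mult_def transpose_def mult.commute
        del: transpose_matrix_vector)
  then have "diag_mat (\<chi> i. if i = e then 1 else 0) *v (transpose Q *v x) = (column e Q \<bullet> x) *\<^sub>R axis e 1"
    by (simp add: vec_eq_iff axis_def del: transpose_matrix_vector)
  then show ?thesis
    by (simp add: matrix_vector_mul_assoc[symmetric] matrix_vector_mult_scaleR matrix_vector_mult_basis
        del: transpose_matrix_vector)
qed

lemma det_identity_plus_orthogonal_conj_coordinate_projection:
  fixes Q :: "real^'n::finite^'n"
  assumes "orthogonal_matrix Q"
  shows "det (1 *\<^sub>R mat 1 + c *\<^sub>R (Q ** diag_mat (\<chi> i. if i = e then 1 else 0) ** transpose Q)) = 1 + c"
proof -
  have "det (1 *\<^sub>R mat 1 + c *\<^sub>R (Q ** diag_mat (\<chi> i. if i = e then 1 else 0) ** transpose Q))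
      = (\<Prod>i\<in>UNIV. 1 + c * (if i = e then 1 else 0))"
    unfolding affine_combination_orthogonal_conj_diag_mat[OF assms] det_orthogonal_conj_diag_mat[OF assms]
    by simp
  also have "\<dots> = 1 + c"
    by (simp add: if_distrib prod.delta cong: if_cong)
  finally show ?thesis .
qed

lemma ellipsoid_between_unit_balls:
  fixes k :: "real^'n::finite"
  assumes "convex S" "cball 0 1 \<subseteq> S" "cball k 1 \<subseteq> S" "k \<noteq> 0"
  obtains N where "1 < det N" "ellipsoid N ((1/2) *\<^sub>R k) \<subseteq> S"
proof -
  obtain e :: 'n where True by simp
  define w where "w = k /\<^sub>R norm k"
  obtain Q where Q: "orthogonal_matrix Q" "Q *v axis e 1 = w"
    using orthogonal_matrix_exists_basis[of w] assms(4) by (auto simp: w_def)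
  then have w: "column e Q = w"
    by (simp add: matrix_vector_mult_basis)
  \<comment> \<open>the unit ball stretched by the factor \<open>1 + norm k / 2\<close> in the direction of k\<close>
  define N where "N = 1 *\<^sub>R mat 1 + (norm k / 2) *\<^sub>R (Q ** diag_mat (\<chi> i. if i = e then 1 else 0) ** transpose Q)"
  have "1 < det N"
    using assms(4) det_identity_plus_orthogonal_conj_coordinate_projection[OF Q(1)] by (simp add: N_def)
  moreover have "ellipsoid N ((1/2) *\<^sub>R k) \<subseteq> S"
  proof
    fix x
    assume "x \<in> ellipsoid N ((1/2) *\<^sub>R k)"
    then obtain u where u: "norm u \<le> 1" "x = N *v u + (1/2) *\<^sub>R k"
      by (rule ellipsoidE)
    define s where "s = (1 + w \<bullet> u) / 2"
    have "\<bar>w \<bullet> u\<bar> \<le> 1"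
      using Cauchy_Schwarz_ineq2[of w u] u(1) assms(4) by (simp add: w_def mult_le_one)
    then have s: "0 \<le> s" "s \<le> 1"
      by (auto simp: s_def)
    have "N *v u = u + (norm k / 2 * (w \<bullet> u)) *\<^sub>R w"
      by (simp add: N_def matrix_vector_mult_add_rdistrib scaleR_matrix_vector_assoc[symmetric]
          orthogonal_conj_coordinate_projection[OF Q(1)] w)
    also have "\<dots> = u + ((w \<bullet> u) / 2) *\<^sub>R k"
      using assms(4) by (simp add: w_def)
    finally have "x = u + s *\<^sub>R k"
      using u(2) by (simp add: s_def add_divide_distrib scaleR_add_left)
    then have "x = (1 - s) *\<^sub>R u + s *\<^sub>R (u + k)"
      by (simp add: algebra_simps)
    moreover have "u \<in> S" "u + k \<in> S"
      using subsetD[OF assms(2), of u] subsetD[OF assms(3), of "u + k"] u(1) by (simp_all add: dist_norm)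
    ultimately show "x \<in> S"
      using convexD_alt[OF assms(1), of u "u + k" s] s by simp
  qed
  ultimately show ?thesis
    using that by blast
qed

lemma ellipsoid_eq_unit_ball_if_max_volume:
  fixes M :: "real^'n::finite^'n"
  assumes S: "convex S" "cball 0 1 \<subseteq> S"
    and max: "\<And>A h. ellipsoid A h \<subseteq> S \<Longrightarrow> \<bar>det A\<bar> \<le> 1"
    and M: "ellipsoid M k \<subseteq> S" "1 \<le> \<bar>det M\<bar>"
  shows "M ** transpose M = mat 1 \<and> k = 0"
proof -
  have max': "det A \<le> 1" if "ellipsoid A h \<subseteq> S" for A h
    using max[OF that] abs_ge_self[of "det A"] by linarith
  have "det M \<noteq> 0"
    using M(2) by auto
  then obtain R where R: "psd R" "det R = \<bar>det M\<bar>" "R ** R = M ** transpose M"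
    and ER: "\<And>h. ellipsoid M h = ellipsoid R h"
    using ellipsoid_eq_psd_ellipsoid by blast
  have "R = mat 1"
  proof (rule ccontr)
    assume "R \<noteq> mat 1"
    then have "1 < det ((1/2) *\<^sub>R (mat 1 + R))"
      using det_midpoint_identity_gt_one[OF R(1) _ \<open>R \<noteq> mat 1\<close>] R(2) M(2) by simp
    moreover have "ellipsoid ((1/2) *\<^sub>R (mat 1 + R)) ((1/2) *\<^sub>R (0 + k)) \<subseteq> S"
      using ellipsoid_midpoint_subset[OF S(1), of "mat 1" 0 R k] S(2) M(1) ER[of k]
      by (simp add: ellipsoid_identity)
    ultimately show False
      using max' by fastforce
  qed
  have "cball k 1 \<subseteq> S"
    using M(1) ER[of k] \<open>R = mat 1\<close> by (simp add: ellipsoid_identity)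
  moreover have "M ** transpose M = mat 1"
    using R(3) \<open>R = mat 1\<close> by simp
  moreover have "k = 0"
  proof (rule ccontr)
    assume "k \<noteq> 0"
    then obtain N where "1 < det N" "ellipsoid N ((1/2) *\<^sub>R k) \<subseteq> S"
      using ellipsoid_between_unit_balls[OF S \<open>cball k 1 \<subseteq> S\<close>] by blast
    with max' show False
      by fastforce
  qed
  ultimately show ?thesis
    by blast
qed

lemma MVIE_abs_det_le:
  fixes C :: "real^'n::finite^'n"
  assumes "is_MVIE P C g" "ellipsoid A h \<subseteq> P"
  shows "\<bar>det A\<bar> \<le> \<bar>det C\<bar>"
proof (cases "det A = 0")
  case False
  then obtain R where "psd R" "det R = \<bar>det A\<bar>" "ellipsoid A h = ellipsoid R h"
    using ellipsoid_eq_psd_ellipsoid[of A] by metis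
  then show ?thesis
    using MVIE_abs_det_le_psd[OF assms(1), of R h] assms(2) by simp
qed simp

lemma convex_affine_vimage:
  fixes C :: "real^'n::finite^'n"
  assumes "convex P"
  shows "convex ((\<lambda>y. C *v y + g) -` P)"
proof -
  have "convex ((*v) C -` (\<lambda>p. - g + p) ` P)"
    by (intro convex_linear_vimage convex_translation matrix_vector_mul_linear assms)
  also have "(*v) C -` (\<lambda>p. - g + p) ` P = (\<lambda>y. C *v y + g) -` P"
    by (auto simp: image_def Bex_def)
  finally show ?thesis .
qed

lemma ellipsoid_subset_affine_vimage_iff:
  fixes C :: "real^'n::finite^'n"
  shows "ellipsoid A h \<subseteq> (\<lambda>y. C *v y + g) -` P \<longleftrightarrow> ellipsoid (C ** A) (C *v h + g) \<subseteq> P"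
  by (simp add: image_subset_iff_subset_vimage[symmetric] ellipsoid_affine_image)

text \<open>Normalise by the affine map \<open>y \<mapsto> C *v y + g\<close>, which sends the unit ball onto the MVIE.\<close>
lemma MVIE_unique:
  fixes C A :: "real^'n::finite^'n"
  assumes MVIE: "is_MVIE P C g" and "convex P" "det C \<noteq> 0"
    and A: "ellipsoid A h \<subseteq> P" "\<bar>det C\<bar> \<le> \<bar>det A\<bar>"
  shows "A ** transpose A = C ** transpose C \<and> h = g"
proof -
  obtain Ci where Ci: "C ** Ci = mat 1" "Ci ** C = mat 1"
    using assms(3) invertible_det_nz[of C] unfolding invertible_def by auto
  let ?Q = "(\<lambda>y. C *v y + g) -` P"
  have "cball 0 1 \<subseteq> ?Q"
    using MVIE ellipsoid_subset_affine_vimage_iff[of "mat 1" 0 C g P]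
    by (simp add: ellipsoid_identity is_MVIE_def)
  moreover have "\<bar>det A'\<bar> \<le> 1" if "ellipsoid A' h' \<subseteq> ?Q" for A' h'
  proof -
    have "\<bar>det (C ** A')\<bar> \<le> \<bar>det C\<bar>"
      using MVIE_abs_det_le[OF MVIE] that by (simp add: ellipsoid_subset_affine_vimage_iff)
    then show ?thesis
      using assms(3) by (simp add: det_mul abs_mult)
  qed
  moreover have "ellipsoid (Ci ** A) (Ci *v (h - g)) \<subseteq> ?Q"
    using A(1) Ci(1)
    by (simp add: ellipsoid_subset_affine_vimage_iff matrix_mul_assoc matrix_vector_mul_assoc)
  moreover have "1 \<le> \<bar>det (Ci ** A)\<bar>"
  proof -
    have "1 = \<bar>det Ci\<bar> * \<bar>det C\<bar>"
      using Ci(2) by (metis abs_1 abs_mult det_I det_mul)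
    also have "\<dots> \<le> \<bar>det Ci\<bar> * \<bar>det A\<bar>"
      using A(2) by (rule mult_left_mono) simp
    finally show ?thesis
      by (simp add: det_mul abs_mult)
  qed
  ultimately have unit: "(Ci ** A) ** transpose (Ci ** A) = mat 1" "Ci *v (h - g) = 0"
    using ellipsoid_eq_unit_ball_if_max_volume[OF convex_affine_vimage[OF assms(2)]] by blast+
  have "A ** transpose A = (C ** (Ci ** A)) ** transpose (C ** (Ci ** A))"
    using Ci(1) by (simp add: matrix_mul_assoc)
  also have "\<dots> = C ** ((Ci ** A) ** transpose (Ci ** A)) ** transpose C"
    by (simp add: matrix_transpose_mul matrix_mul_assoc)
  finally have AA: "A ** transpose A = C ** transpose C"
    using unit(1) by simp
  have "h - g = C *v (Ci *v (h - g))"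
    using Ci(1) by (simp add: matrix_vector_mul_assoc)
  also have "\<dots> = 0"
    using unit(2) by simp
  finally show ?thesis
    using AA by simp
qed

lemma MVIE_nonsingular:
  fixes C :: "real^'n::finite^'n"
  assumes "is_MVIE P C g" "interior P \<noteq> {}"
  shows "det C \<noteq> 0"
proof -
  obtain x r where "0 < r" "cball x r \<subseteq> P"
    using assms(2) by (metis all_not_in_conv mem_interior_cball)
  define D :: "real^'n^'n" where "D = diag_mat (\<chi> i. r)"
  have "ellipsoid D x \<subseteq> cball x r"
  proof
    fix y
    assume "y \<in> ellipsoid D x"
    then obtain u where u: "norm u \<le> 1" "y = D *v u + x"
      by (rule ellipsoidE)
    have "D *v u = r *\<^sub>R u"
      by (simp add: D_def vec_eq_iff)
    then have "dist x y = r * norm u"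
      using \<open>0 < r\<close> by (simp add: u(2) dist_norm)
    also have "\<dots> \<le> r"
      using \<open>0 < r\<close> u(1) by (simp add: mult_left_le)
    finally show "y \<in> cball x r"
      by simp
  qed
  then have "\<bar>det D\<bar> \<le> \<bar>det C\<bar>"
    using \<open>cball x r \<subseteq> P\<close> by (intro MVIE_abs_det_le[OF assms(1)]) (rule order_trans)
  moreover have "0 < det D"
    using \<open>0 < r\<close> by (simp add: D_def)
  ultimately show ?thesis
    by auto
qed

section \<open>Polars\<close>

lemma polar_wrt_eq_Inter: "polar_wrt X d = (\<Inter>y\<in>X. {x. (y - d) \<bullet> x \<le> 1})"
  by (auto simp: polar_wrt_def inner_commute)

lemma convex_polar_wrt: "convex (polar_wrt X d)"
  unfolding polar_wrt_eq_Inter by (intro convex_INT convex_halfspace_le)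

lemma closed_polar_wrt: "closed (polar_wrt X (d::real^'n::finite))"
  unfolding polar_wrt_eq_Inter by (intro closed_INT ballI closed_halfspace_le)

lemma polar_wrt_antimono: "X \<subseteq> Y \<Longrightarrow> polar_wrt Y d \<subseteq> polar_wrt X d"
  by (auto simp: polar_wrt_def)

lemma polar_wrt_convex_hull: "polar_wrt (convex hull X) d = polar_wrt X (d::real^'n::finite)"
proof
  show "polar_wrt (convex hull X) d \<subseteq> polar_wrt X d"
    by (rule polar_wrt_antimono[OF hull_subset])
  show "polar_wrt X d \<subseteq> polar_wrt (convex hull X) d"
  proof
    fix x
    assume "x \<in> polar_wrt X d"
    then have "convex hull X \<subseteq> {y. x \<bullet> y \<le> 1 + x \<bullet> d}"
      by (intro hull_minimal) (auto simp: polar_wrt_def inner_diff_right convex_halfspace_le)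
    then show "x \<in> polar_wrt (convex hull X) d"
      by (auto simp: polar_wrt_def inner_diff_right)
  qed
qed

lemma polyhedron_polar_wrt:
  assumes "finite V"
  shows "polyhedron (polar_wrt V (d::real^'n::finite))"
  unfolding polar_wrt_eq_Inter using assms by (auto intro: polyhedron_halfspace_le)

lemma polar_wrt_ellipsoid:
  fixes C :: "real^'n::finite^'n"
  assumes "transpose C = C"
  shows "polar_wrt (ellipsoid C g) g = {x. norm (C *v x) \<le> 1}"
proof -
  have "x \<in> polar_wrt (ellipsoid C g) g \<longleftrightarrow> (\<forall>u. norm u \<le> 1 \<longrightarrow> (C *v x) \<bullet> u \<le> 1)" for x
    using inner_matrix_vector_transpose[of x C] assms by (auto simp: polar_wrt_def ellipsoid_def)
  moreover have "(\<forall>u. norm u \<le> 1 \<longrightarrow> v \<bullet> u \<le> 1) \<longleftrightarrow> norm v \<le> 1" for v :: "real^'n"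
  proof
    assume dual: "\<forall>u. norm u \<le> 1 \<longrightarrow> v \<bullet> u \<le> 1"
    show "norm v \<le> 1"
    proof (cases "v = 0")
      case False
      then have "v \<bullet> (v /\<^sub>R norm v) = norm v"
        by (simp add: dot_square_norm power2_eq_square)
      then show ?thesis
        using dual False by (metis norm_sgn sgn_div_norm order_refl)
    qed simp
  next
    assume "norm v \<le> 1"
    then show "\<forall>u. norm u \<le> 1 \<longrightarrow> v \<bullet> u \<le> 1"
      by (metis mult_le_one norm_cauchy_schwarz norm_ge_zero order_trans)
  qed
  ultimately show ?thesis
    by auto
qed

lemma frontier_injective_linear_image:
  fixes f :: "'a::euclidean_space \<Rightarrow> 'a"
  assumes "linear f" "inj f"
  shows "frontier (f ` S) = f ` frontier S"
  using assms
  by (simp add: frontier_def closure_injective_linear_image[symmetric] interior_injective_linear_image image_set_diff)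

lemma not_in_convex_imp_polar_wrt:
  fixes P :: "(real^'n::finite) set"
  assumes "convex P" "closed P" "d \<in> P" "z \<notin> P"
  obtains a where "a \<in> polar_wrt P d" "1 < a \<bullet> (z - d)"
proof -
  obtain c b where cb: "c \<bullet> z < b" "\<And>x. x \<in> P \<Longrightarrow> b < c \<bullet> x"
    using separating_hyperplane_closed_point[OF assms(1,2,4)] by blast
  define t where "t = c \<bullet> d - b"
  have "0 < t"
    using cb(2)[OF assms(3)] by (simp add: t_def)
  have polar: "(- c /\<^sub>R t) \<bullet> (x - d) = (c \<bullet> d - c \<bullet> x) / t" for x
    by (simp add: inner_diff_right divide_simps)
  have "(- c /\<^sub>R t) \<bullet> (x - d) < 1" if "x \<in> P" for x
    using cb(2)[OF that] \<open>0 < t\<close> unfolding polar by (simp add: t_def)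
  then have "- c /\<^sub>R t \<in> polar_wrt P d"
    by (auto simp: polar_wrt_def less_imp_le)
  moreover have "1 < (- c /\<^sub>R t) \<bullet> (z - d)"
    using cb(1) \<open>0 < t\<close> unfolding polar by (simp add: t_def)
  ultimately show ?thesis
    using that by blast
qed

text \<open>By Krein--Milman the polar is the convex hull of its extreme points, so by the bipolar
  theorem it suffices to test the polar inequalities of the image at those extreme points.\<close>
lemma maps_into_if_adjoint_maps_polar_extreme_points:
  fixes V :: "real^'n::finite^'n" and P :: "(real^'n) set"
  assumes P: "convex P" "closed P" "d \<in> P" and "V *v d = d"
    and "compact (polar_wrt P d)"
    and ext: "\<And>a. a extreme_point_of polar_wrt P d \<Longrightarrow> transpose V *v a \<in> polar_wrt P d"
    and "y \<in> P"
  shows "V *v y \<in> P"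
proof (rule ccontr)
  assume "V *v y \<notin> P"
  then obtain a where a: "a \<in> polar_wrt P d" "1 < a \<bullet> (V *v y - d)"
    using not_in_convex_imp_polar_wrt[OF P] by blast
  have "{e. e extreme_point_of polar_wrt P d} \<subseteq> {e. (V *v y - d) \<bullet> e \<le> 1}"
  proof safe
    fix e
    assume "e extreme_point_of polar_wrt P d"
    then have "(transpose V *v e) \<bullet> (y - d) \<le> 1"
      using ext \<open>y \<in> P\<close> by (auto simp: polar_wrt_def)
    moreover have "(transpose V *v e) \<bullet> (y - d) = (V *v y - d) \<bullet> e"
      using inner_matrix_vector_transpose[of e V "y - d"] \<open>V *v d = d\<close>
      by (simp add: matrix_vector_mult_diff_distrib inner_commute del: transpose_matrix_vector)
    ultimately show "(V *v y - d) \<bullet> e \<le> 1"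
      by simp
  qed
  then have "convex hull {e. e extreme_point_of polar_wrt P d} \<subseteq> {e. (V *v y - d) \<bullet> e \<le> 1}"
    by (intro hull_minimal convex_halfspace_le)
  moreover have "polar_wrt P d = convex hull {e. e extreme_point_of polar_wrt P d}"
    using Krein_Milman_Minkowski[OF \<open>compact (polar_wrt P d)\<close> convex_polar_wrt] .
  ultimately show False
    using a by (auto simp: inner_commute)
qed

section \<open>The simplex \<open>B\<^sub>1\<^sub>,\<^sub>+\<close>\<close>

lemma Basis_vec_eq_axis: "(Basis :: (real^'n::finite) set) = range (\<lambda>i. axis i 1)"
  by (auto simp: Basis_vec_def)

lemma simplex_B1plus_eq_std_simplex:
  "(simplex_B1plus :: (real^'n::finite) set) = convex hull (insert 0 Basis)"
proof -
  have "inj (\<lambda>i::'n. axis i (1::real))"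
    by (auto simp: inj_def axis_eq_axis)
  then have "(\<Sum>b\<in>Basis. x \<bullet> b) = (\<Sum>i\<in>UNIV. x $ i)" for x :: "real^'n"
    by (simp add: Basis_vec_eq_axis sum.reindex inner_axis)
  then show ?thesis
    unfolding simplex_B1plus_def std_simplex by (auto simp: Basis_vec_eq_axis inner_axis)
qed

lemma interior_simplex_B1plus_nonempty: "interior (simplex_B1plus :: (real^'n::finite) set) \<noteq> {}"
  unfolding simplex_B1plus_eq_std_simplex using interior_std_simplex_nonempty by blast

lemma extreme_point_of_simplex_B1plus:
  "x extreme_point_of (simplex_B1plus :: (real^'n::finite) set) \<longleftrightarrow> x \<in> insert 0 Basis"
proof -
  have "\<not> affine_dependent (insert 0 (Basis :: (real^'n) set))"
    using affine_dependent_iff_dependent[of 0 Basis] independent_Basis nonzero_Basis by auto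
  then show ?thesis
    unfolding simplex_B1plus_eq_std_simplex by (rule extreme_point_of_convex_hull_affine_independent)
qed

lemma extreme_point_of_linear_image:
  fixes f :: "'a::euclidean_space \<Rightarrow> 'b::euclidean_space"
  assumes "linear f" "inj f"
  shows "f x extreme_point_of f ` S \<longleftrightarrow> x extreme_point_of S"
  using face_of_linear_image[OF assms, of "{x}" S] by (simp add: face_of_singleton)

lemma perm_matrix_if_maps_simplex_B1plus_onto:
  fixes W :: "real^'n::finite^'n"
  assumes inj: "inj ((*v) W)" and onto: "(*v) W ` simplex_B1plus = simplex_B1plus"
  shows "perm_matrix W"
proof -
  have "W *v b \<in> insert 0 Basis" if "b \<in> Basis" for b
    using extreme_point_of_linear_image[OF matrix_vector_mul_linear inj, of b simplex_B1plus] that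
    by (simp add: onto extreme_point_of_simplex_B1plus)
  moreover have "W *v b \<noteq> 0" if "b \<in> Basis" for b
    using inj that nonzero_Basis by (metis injD matrix_vector_mult_0_right)
  ultimately have "\<exists>i. W *v axis j 1 = axis i 1" for j
    by (auto simp: Basis_vec_eq_axis)
  then obtain p where p: "\<And>j. W *v axis j 1 = axis (p j) 1"
    by metis
  have "inj p"
    using inj by (metis injI injD p axis_eq_axis zero_neq_one)
  then have "p permutes UNIV"
    using finite_UNIV_inj_surj[of p] bij_imp_permutes[of p UNIV] by (simp add: bij_def)
  have "W $ i $ j = (W *v axis j 1) $ i" for i j
    by (simp add: matrix_vector_mult_basis column_def)
  also have "\<dots> i j = (if inv p i = j then 1 else 0)" for i j
    using permutes_inverses[OF \<open>p permutes UNIV\<close>] unfolding p by (auto simp: axis_def)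
  finally have "W $ i $ j = (if inv p i = j then 1 else 0)" for i j .
  then show ?thesis
    unfolding perm_matrix_def using permutes_inv[OF \<open>p permutes UNIV\<close>] by (auto simp: vec_eq_iff)
qed

section \<open>Identifiability\<close>

lemma norm_matrix_vector_eq_if_gram_eq:
  fixes A B :: "real^'n::finite^'m::finite"
  assumes "transpose A ** A = transpose B ** B"
  shows "norm (A *v x) = norm (B *v x)"
proof -
  have gram: "(M *v x) \<bullet> (M *v x) = x \<bullet> ((transpose M ** M) *v x)" for M :: "real^'n^'m"
    using inner_matrix_vector_transpose[of x "transpose M" "M *v x"]
    by (simp add: matrix_vector_mul_assoc[symmetric] del: transpose_matrix_vector)
  show ?thesis
    using gram[of A] gram[of B] assms by (simp add: norm_eq_sqrt_inner)
qed

lemma compact_polar_wrt_if_ellipsoid_subset: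
  fixes C :: "real^'n::finite^'n"
  assumes "transpose C = C" "det C \<noteq> 0" "ellipsoid C g \<subseteq> P"
  shows "compact (polar_wrt P g)"
proof -
  obtain Ci where "Ci ** C = mat 1"
    using assms(2) invertible_det_nz[of C] unfolding invertible_def by auto
  have "x \<in> (*v) Ci ` cball 0 1" if "norm (C *v x) \<le> 1" for x
  proof (rule image_eqI)
    show "x = Ci *v (C *v x)"
      using \<open>Ci ** C = mat 1\<close> by (simp add: matrix_vector_mul_assoc)
    show "C *v x \<in> cball 0 1"
      using that by simp
  qed
  then have "{x. norm (C *v x) \<le> 1} \<subseteq> (*v) Ci ` cball 0 1"
    by blast
  moreover have "polar_wrt P g \<subseteq> {x. norm (C *v x) \<le> 1}"
    using polar_wrt_antimono[OF assms(3), of g] polar_wrt_ellipsoid[OF assms(1), of g] by simp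
  moreover have "bounded ((*v) Ci ` cball 0 1)"
    by (intro bounded_linear_image bounded_cball matrix_vector_mul_bounded_linear)
  ultimately have "bounded (polar_wrt P g)"
    by (meson bounded_subset order_trans)
  then show ?thesis
    by (simp add: compact_eq_bounded_closed closed_polar_wrt)
qed

lemma MVIE_invariant_map:
  fixes C W :: "real^'n::finite^'n"
  assumes MVIE: "is_MVIE P C g" and "convex P" "det C \<noteq> 0"
    and "(*v) W ` ellipsoid C g \<subseteq> P" "1 \<le> \<bar>det W\<bar>"
  shows "W *v g = g" "norm (C *v (transpose W *v x)) = norm (C *v x)"
proof -
  have "(*v) W ` ellipsoid C g = ellipsoid (W ** C) (W *v g)"
    using ellipsoid_affine_image[of W 0] by simp
  then have "ellipsoid (W ** C) (W *v g) \<subseteq> P"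
    using assms(4) by simp
  moreover have "\<bar>det C\<bar> \<le> \<bar>det (W ** C)\<bar>"
    using mult_right_mono[OF assms(5) abs_ge_zero[of "det C"]] by (simp add: det_mul abs_mult)
  ultimately have WC: "(W ** C) ** transpose (W ** C) = C ** transpose C" and "W *v g = g"
    using MVIE_unique[OF MVIE assms(2,3)] by blast+
  then show "W *v g = g"
    by simp
  have "transpose C = C"
    using MVIE by (simp add: is_MVIE_def psd_def)
  then have "transpose (C ** transpose W) ** (C ** transpose W) = transpose C ** C"
    using WC by (simp add: matrix_transpose_mul matrix_mul_assoc)
  then have "norm ((C ** transpose W) *v x) = norm (C *v x)"
    by (rule norm_matrix_vector_eq_if_gram_eq)
  then show "norm (C *v (transpose W *v x)) = norm (C *v x)"
    by (simp add: matrix_vector_mul_assoc del: transpose_matrix_vector)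
qed

text \<open>This is where sufficient scatteredness enters. Both sets on its left-hand side are invariant
  under the adjoint of W: the polar of the data because W maps the data into P and fixes g, the
  boundary of the polar of the MVIE because the adjoint preserves the norm \<open>norm (C *v x)\<close>.\<close>
lemma adjoint_preserves_polar_extreme_points:
  fixes C W :: "real^'n::finite^'n"
  assumes scattered: "polar_wrt X g \<inter> frontier (polar_wrt (ellipsoid C g) g)
      = {v. v extreme_point_of polar_wrt P g}"
    and "transpose C = C" "(*v) W ` X \<subseteq> P" "W *v g = g" "W ** W' = mat 1"
    and norm: "\<And>x. norm (C *v (transpose W *v x)) = norm (C *v x)"
    and a: "a extreme_point_of polar_wrt P g"
  shows "(transpose W *v a) extreme_point_of polar_wrt P g"
proof -
  define K where "K = polar_wrt (ellipsoid C g) g"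
  have K: "K = {x. norm (C *v x) \<le> 1}"
    unfolding K_def by (rule polar_wrt_ellipsoid[OF assms(2)])
  have "W' ** W = mat 1"
    using assms(5) matrix_left_right_inverse by blast
  then have inv: "transpose W ** transpose W' = mat 1" "transpose W' ** transpose W = mat 1"
    using assms(5) by (metis matrix_transpose_mul transpose_mat)+
  have "x \<in> (*v) (transpose W) ` K" if "x \<in> K" for x
  proof (rule image_eqI)
    show "x = transpose W *v (transpose W' *v x)"
      using inv(1) by (simp add: matrix_vector_mul_assoc del: transpose_matrix_vector)
    then show "transpose W' *v x \<in> K"
      using that norm[of "transpose W' *v x"] by (simp add: K del: transpose_matrix_vector)
  qed
  moreover have "transpose W *v x \<in> K" if "x \<in> K" for x
    using that norm[of x] by (simp add: K del: transpose_matrix_vector)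
  ultimately have "(*v) (transpose W) ` K = K"
    by blast
  moreover have "inj ((*v) (transpose W))"
    using inv(2) matrix_left_invertible_injective by blast
  ultimately have "(*v) (transpose W) ` frontier K = frontier K"
    by (metis frontier_injective_linear_image matrix_vector_mul_linear)
  moreover have "a \<in> polar_wrt X g" "a \<in> frontier K" "a \<in> polar_wrt P g"
    using a scattered by (auto simp: K_def extreme_point_of_def)
  moreover have "transpose W *v a \<in> polar_wrt X g"
    unfolding polar_wrt_def
  proof (intro CollectI ballI)
    fix y
    assume "y \<in> X"
    then have "a \<bullet> (W *v y - g) \<le> 1"
      using assms(3) \<open>a \<in> polar_wrt P g\<close> by (auto simp: polar_wrt_def)
    then show "(transpose W *v a) \<bullet> (y - g) \<le> 1"
      using inner_matrix_vector_transpose[of a W "y - g"] assms(4)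
      by (simp add: matrix_vector_mult_diff_distrib del: transpose_matrix_vector)
  qed
  ultimately have "transpose W *v a \<in> polar_wrt X g \<inter> frontier K"
    by blast
  then show ?thesis
    using scattered unfolding K_def by blast
qed

lemma inverse_maps_into_if_injective_self_map:
  assumes "finite E" "f ` E \<subseteq> E" "inj_on f E" "\<And>x. x \<in> E \<Longrightarrow> g (f x) = x"
  shows "g ` E \<subseteq> E"
proof -
  have "f ` E = E"
    using assms(1-3) by (rule endo_inj_surj)
  show ?thesis
  proof
    fix y
    assume "y \<in> g ` E"
    then obtain x where "x \<in> E" "y = g x"
      by blast
    then obtain z where "z \<in> E" "x = f z"
      using \<open>f ` E = E\<close> by blast
    then show "y \<in> E"
      using assms(4) \<open>y = g x\<close> by simp
  qed
qed

lemma maps_onto_if_adjoint_preserves_polar_extreme_points: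
  fixes W W' :: "real^'n::finite^'n" and P :: "(real^'n) set"
  assumes P: "convex P" "closed P" "g \<in> P" "compact (polar_wrt P g)"
    and fin: "finite {v. v extreme_point_of polar_wrt P g}"
    and W: "W ** W' = mat 1" "W *v g = g"
    and ext: "\<And>a. a extreme_point_of polar_wrt P g \<Longrightarrow> (transpose W *v a) extreme_point_of polar_wrt P g"
  shows "(*v) W ` P = P"
proof -
  have "W' ** W = mat 1"
    using W(1) by (simp add: matrix_left_right_inverse)
  have "W' *v g = W' *v (W *v g)"
    using W(2) by simp
  also have "\<dots> = g"
    using \<open>W' ** W = mat 1\<close> by (simp add: matrix_vector_mul_assoc)
  finally have W'g: "W' *v g = g" .
  have "transpose W' ** transpose W = mat 1"
    using W(1) by (metis matrix_transpose_mul transpose_mat)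
  then have inv: "transpose W' *v (transpose W *v a) = a" for a
    by (simp add: matrix_vector_mul_assoc del: transpose_matrix_vector)
  have "inj ((*v) (transpose W))"
    using \<open>transpose W' ** transpose W = mat 1\<close> matrix_left_invertible_injective by blast
  define Ext where "Ext = {v. v extreme_point_of polar_wrt P g}"
  have "(*v) (transpose W) ` Ext \<subseteq> Ext"
    using ext by (auto simp: Ext_def)
  moreover have "inj_on ((*v) (transpose W)) Ext"
    using \<open>inj ((*v) (transpose W))\<close> by (rule inj_on_subset) simp
  ultimately have "(*v) (transpose W') ` Ext \<subseteq> Ext"
    using inverse_maps_into_if_injective_self_map[OF fin[folded Ext_def]] inv by blast
  then have "transpose W *v a \<in> Ext" "transpose W' *v a \<in> Ext" if "a \<in> Ext" for a
    using that ext by (auto simp: Ext_def)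
  then have "transpose W *v a \<in> polar_wrt P g" "transpose W' *v a \<in> polar_wrt P g"
    if "a extreme_point_of polar_wrt P g" for a
    using that unfolding Ext_def extreme_point_of_def by blast+
  then have WP: "W *v y \<in> P" and W'P: "W' *v y \<in> P" if "y \<in> P" for y
    using maps_into_if_adjoint_maps_polar_extreme_points[OF P(1-3) _ P(4) _ that] W(2) W'g by blast+
  show ?thesis
  proof (intro subset_antisym subsetI)
    show "x \<in> P" if "x \<in> (*v) W ` P" for x
      using that WP by blast
    show "y \<in> (*v) W ` P" if "y \<in> P" for y
    proof (rule image_eqI)
      show "y = W *v (W' *v y)"
        using W(1) by (simp add: matrix_vector_mul_assoc)
    qed (rule W'P[OF that])
  qed
qed

lemma suff_scattered_map_onto:
  fixes S :: "real^'k::finite^'n::finite" and W W' :: "real^'n^'n"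
  assumes "suff_scattered S P" "P = convex hull V" "finite V" "interior P \<noteq> {}"
    and W: "W ** W' = mat 1" "1 \<le> \<bar>det W\<bar>" "(*v) W ` col_set S \<subseteq> P"
  shows "(*v) W ` P = P"
proof -
  obtain C g where MVIE: "is_MVIE P C g" and EC: "ellipsoid C g \<subseteq> convex hull (col_set S)"
    and scattered: "polar_wrt (convex hull (col_set S)) g \<inter> frontier (polar_wrt (ellipsoid C g) g)
      = {v. v extreme_point_of polar_wrt P g}"
    using assms(1) unfolding suff_scattered_def by blast
  have P: "convex P" "closed P"
    using assms(2,3) by (simp_all add: compact_imp_closed finite_imp_compact_convex_hull)
  have "det C \<noteq> 0" "transpose C = C" "ellipsoid C g \<subseteq> P"
    using MVIE_nonsingular[OF MVIE assms(4)] MVIE by (auto simp: is_MVIE_def psd_def)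
  then have "g \<in> P" "compact (polar_wrt P g)"
    using center_in_ellipsoid compact_polar_wrt_if_ellipsoid_subset by blast+
  have "(*v) W ` (convex hull (col_set S)) \<subseteq> P"
    unfolding convex_hull_linear_image[OF matrix_vector_mul_linear] using W(3) P(1) by (rule hull_minimal)
  then have "(*v) W ` ellipsoid C g \<subseteq> P"
    using EC by blast
  note invariant = MVIE_invariant_map[OF MVIE P(1) \<open>det C \<noteq> 0\<close> this W(2)]
  have "finite {v. v extreme_point_of polar_wrt P g}"
    unfolding assms(2) polar_wrt_convex_hull
    by (intro finite_polyhedron_extreme_points polyhedron_polar_wrt assms(3))
  then show ?thesis
    using maps_onto_if_adjoint_preserves_polar_extreme_points[OF P \<open>g \<in> P\<close> \<open>compact (polar_wrt P g)\<close> _ W(1)]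
      adjoint_preserves_polar_extreme_points[OF scattered \<open>transpose C = C\<close>
        \<open>(*v) W ` (convex hull (col_set S)) \<subseteq> P\<close> invariant(1) W(1) invariant(2)]
      invariant(1) by blast
qed

lemma right_invertible_if_ellipsoid_in_convex_hull_columns:
  fixes S :: "real^'k::finite^'n::finite" and C :: "real^'n^'n"
  assumes "det C \<noteq> 0" "ellipsoid C g \<subseteq> convex hull (col_set S)"
  shows "\<exists>R. S ** R = mat 1"
proof -
  obtain Ci where Ci: "C ** Ci = mat 1"
    using assms(1) invertible_det_nz[of C] unfolding invertible_def by auto
  have E: "ellipsoid C g \<subseteq> span (col_set S)"
    using assms(2) convex_hull_subset_span by blast
  have unit: "C *v u \<in> span (col_set S)" if "norm u \<le> 1" for u
    using span_diff[OF subsetD[OF E ellipsoidI[OF that]] subsetD[OF E center_in_ellipsoid]] by simp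
  have "C *v u \<in> span (col_set S)" for u
  proof (cases "u = 0")
    case False
    have "norm u *\<^sub>R (C *v (u /\<^sub>R norm u)) \<in> span (col_set S)"
      by (intro span_scale unit) (use False in simp)
    with False show ?thesis
      by (simp add: matrix_vector_mult_scaleR)
  qed (simp add: span_zero)
  then have "x \<in> span (col_set S)" for x
    using Ci by (metis matrix_vector_mul_assoc matrix_vector_mul_lid)
  moreover have "col_set S = columns S"
    by (simp add: col_set_def columns_def)
  ultimately have "span (columns S) = UNIV"
    by auto
  then show ?thesis
    by (simp add: matrix_right_invertible_span_columns span_vec_eq)
qed

lemma det_gram_pos_if_right_invertible:
  fixes S :: "real^'k::finite^'n::finite"
  assumes "S ** R = mat 1"
  shows "0 < det (S ** transpose S)"
proof (rule det_pos_if_pos_definite)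
  show "transpose (S ** transpose S) = S ** transpose S"
    by (simp add: matrix_transpose_mul)
  fix x :: "real^'n"
  assume "x \<noteq> 0"
  have "transpose R *v (transpose S *v x) = x"
    using assms by (simp add: matrix_vector_mul_assoc flip: matrix_transpose_mul del: transpose_matrix_vector)
  with \<open>x \<noteq> 0\<close> have "transpose S *v x \<noteq> 0"
    by auto
  then have "0 < (transpose S *v x) \<bullet> (transpose S *v x)"
    by simp
  also have "\<dots> = x \<bullet> ((S ** transpose S) *v x)"
    using inner_matrix_vector_transpose[of x S "transpose S *v x"]
    by (simp add: matrix_vector_mul_assoc del: transpose_matrix_vector)
  finally show "0 < x \<bullet> ((S ** transpose S) *v x)" .
qed

lemma factorization_through_invertible:
  fixes Hg Hs :: "real^'r::finite^'m::finite" and Sg Ss :: "real^'n::finite^'r"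
  assumes "L ** Hg = mat 1" "Sg ** R = mat 1" "Hg ** Sg = Hs ** Ss"
  obtains W W' where "W ** W' = mat 1" "Ss = W ** Sg" "Hs = Hg ** W'"
proof
  have "Sg = (L ** Hs) ** Ss"
    by (metis assms(1,3) matrix_mul_assoc matrix_mul_lid)
  then have "(L ** Hs) ** (Ss ** R) = mat 1"
    using assms(2) by (simp add: matrix_mul_assoc)
  then show WW': "(Ss ** R) ** (L ** Hs) = mat 1"
    using matrix_left_right_inverse by blast
  show "Ss = (Ss ** R) ** Sg"
    using WW' \<open>Sg = (L ** Hs) ** Ss\<close> by (metis matrix_mul_assoc matrix_mul_lid)
  show "Hs = Hg ** (L ** Hs)"
    using WW' assms(2,3) by (metis matrix_mul_assoc matrix_mul_rid)
qed

lemma perm_matrix_orthogonal: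
  assumes "perm_matrix (Q :: real^'n::finite^'n)"
  shows "transpose Q ** Q = mat 1"
proof -
  obtain p where p: "p permutes UNIV" "Q = (\<chi> i j. if p i = j then 1 else 0)"
    using assms unfolding perm_matrix_def by blast
  have "column j Q = axis (inv p j) 1" for j
    using permutes_inverses[OF p(1)] by (auto simp: p(2) column_def axis_def vec_eq_iff)
  moreover have "inv p i = inv p j \<longleftrightarrow> i = j" for i j
    using permutes_inv[OF p(1)] by (metis permutes_inverses(1) p(1))
  ultimately have "orthogonal_matrix Q"
    by (auto simp: orthogonal_matrix_orthonormal_columns orthogonal_def inner_axis_axis)
  then show ?thesis
    by (simp add: orthogonal_matrix_def)
qed

lemma abs_det_ge_one_if_gram_det_le:
  fixes S :: "real^'k::finite^'n::finite" and W :: "real^'n^'n"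
  assumes "S ** R = mat 1" "det (S ** transpose S) \<le> det ((W ** S) ** transpose (W ** S))"
  shows "1 \<le> \<bar>det W\<bar>"
proof -
  have "(W ** S) ** transpose (W ** S) = W ** (S ** transpose S) ** transpose W"
    by (simp add: matrix_transpose_mul matrix_mul_assoc)
  then have "det (S ** transpose S) \<le> (det W)\<^sup>2 * det (S ** transpose S)"
    using assms(2) by (simp add: det_mul det_transpose power2_eq_square mult_ac)
  then have "1 \<le> (det W)\<^sup>2"
    using det_gram_pos_if_right_invertible[OF assms(1)] by simp
  then show ?thesis
    using abs_square_less_1[of "det W"] by linarith
qed

theorem theorem5:
  fixes Hg :: "real^'r^'m" and Sg :: "real^'n^'r"
    and Hs :: "real^'r^'m" and Ss :: "real^'n^'r"
  assumes "CARD('r) \<le> CARD('m)" and "CARD('r) \<le> CARD('n)"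
    and "rank Hg = CARD('r)"
    and "\<forall>j. column j Sg \<in> simplex_B1plus"
    and "suff_scattered Sg simplex_B1plus"
    and "Hg ** Sg = Hs ** Ss"
    and "\<forall>j. column j Ss \<in> simplex_B1plus"
    and "\<forall>(H::real^'r^'m) (S::real^'n^'r).
           Hg ** Sg = H ** S \<and> (\<forall>j. column j S \<in> simplex_B1plus) \<longrightarrow>
           det (S ** transpose S) \<le> det (Ss ** transpose Ss)"
  shows "\<exists>Q. perm_matrix Q \<and> Hs = Hg ** transpose Q \<and> Ss = Q ** Sg"
proof -
  obtain C g where "is_MVIE simplex_B1plus C g" "ellipsoid C g \<subseteq> convex hull (col_set Sg)"
    using assms(5) unfolding suff_scattered_def by blast
  then obtain R where R: "Sg ** R = mat 1"
    using MVIE_nonsingular interior_simplex_B1plus_nonempty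
      right_invertible_if_ellipsoid_in_convex_hull_columns by metis
  obtain L where "L ** Hg = mat 1"
    using assms(3) full_rank_injective matrix_left_invertible_injective by blast
  then obtain W W' where W: "W ** W' = mat 1" "Ss = W ** Sg" "Hs = Hg ** W'"
    using factorization_through_invertible R assms(6) by blast
  have "1 \<le> \<bar>det W\<bar>"
    using assms(4,8) W(2) by (intro abs_det_ge_one_if_gram_det_le[OF R]) blast
  moreover have "(*v) W ` col_set Sg \<subseteq> simplex_B1plus"
    using assms(7) by (auto simp: col_set_def W(2) column_matrix_mult)
  ultimately have "(*v) W ` simplex_B1plus = simplex_B1plus"
    using suff_scattered_map_onto[OF assms(5) simplex_B1plus_eq_std_simplex _
        interior_simplex_B1plus_nonempty W(1)] by simp
  moreover have "inj ((*v) W)"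
    using W(1) matrix_left_right_inverse matrix_left_invertible_injective by blast
  ultimately have "perm_matrix W"
    by (rule perm_matrix_if_maps_simplex_B1plus_onto[rotated])
  moreover have "W' = transpose W"
    using perm_matrix_orthogonal[OF \<open>perm_matrix W\<close>] W(1)
    by (metis matrix_mul_assoc matrix_mul_lid matrix_mul_rid)
  ultimately show ?thesis
    using W by blast
qed

end
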